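(* For every integer $n\ge 2$, the Wiener index of the Fibonacci cube $\Gamma_n$ is $$W(\Gamma_n)=\frac{1}{25}\Big((3n+2)f_{2n+3}+(n-2)f_{2n+2}-(n+2)(-1)^n\Big).$$
   Context: Fibonacci numbers: $f_0=0$, $f_1=1$, $f_n=f_{n-1}+f_{n-2}$ for $n\ge 2$. Fibonacci cube: for $n\ge 1$, $\Gamma_n$ is the graph whose vertices are the binary strings $b_1b_2\ldots b_n\in\{0,1\}^n$ with $b_i\cdot b_{i+1}=0$ for all $1\le i\le n-1$ (no two consecutive 1s), two vertices being adjacent if and only if they differ in exactly one coordinate (i.e. the subgraph of the $n$-dimensional hypercube induced by these strings). Wiener index: for a connected graph $G$, $W(G)$ is the sum of the shortest path distances $d(u,v)$ over all unordered pairs $\{u,v\}$ of vertices of $G$. *)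

theory Defs
  imports
    "Graph_Theory.Graph_Theory"
    "HOL-Number_Theory.Fib"
begin

section \<open>Distance and Wiener index\<close>

text \<open>
  An undirected simple graph is a symmetric loop-free digraph without parallel arcs
  (locales \<^locale>\<open>graph\<close> and \<^locale>\<open>pair_graph\<close>). The distance is the cost of a cheapest
  walk when every arc costs 1; it is \<open>\<infinity>\<close> if there is no walk.
\<close>

definition graph_dist :: "('a, 'b) pre_digraph \<Rightarrow> 'a \<Rightarrow> 'a \<Rightarrow> ereal" where
  "graph_dist G u v = wf_digraph.\<mu> G (\<lambda>_. 1) u v"

text \<open>
  An unordered pair of distinct vertices is a two-element set of vertices. The description
  is well defined on an undirected graph because the distance is symmetric
  (see \<open>pair_dist_eq\<close> below). The pairs \<open>{u, u}\<close> would contribute 0. If a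
  finite graph is disconnected, the value is \<open>\<infinity>\<close>, so equality with a real number includes connectedness.
\<close>

definition pair_dist :: "('a, 'b) pre_digraph \<Rightarrow> 'a set \<Rightarrow> ereal" where
  "pair_dist G e = (THE d. \<exists>u v. e = {u, v} \<and> d = graph_dist G u v)"

definition wiener_index :: "('a, 'b) pre_digraph \<Rightarrow> ereal" where
  "wiener_index G = (\<Sum>e | e \<subseteq> verts G \<and> card e = 2. pair_dist G e)"

lemma (in wf_digraph) graph_dist_conv:
  "graph_dist G u v = (INF p\<in>{p. awalk u p v}. ereal (real (length p)))"
proof -
  have "awalk_cost (\<lambda>_. 1) p = real (length p)" for p
    by (induction p) auto
  then show ?thesis by (simp add: graph_dist_def \<mu>_def)
qed

lemma (in sym_digraph) awalk_reverse:
  "awalk u p v \<Longrightarrow> \<exists>q. awalk v q u \<and> length q = length p"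
proof (induction p arbitrary: u)
  case Nil
  then show ?case by (intro exI[of _ "[]"]) (auto simp: awalk_Nil_iff)
next
  case (Cons e p)
  then have e: "e \<in> arcs G" "tail G e = u" and "awalk (head G e) p v"
    by (auto simp: awalk_Cons_iff)
  then obtain q where q: "awalk v q (head G e)" "length q = length p"
    using Cons.IH by blast
  obtain e' where e': "e' \<in> arcs G" "tail G e' = head G e" "head G e' = u"
    using sym_arcs e by (metis symmetric_conv)
  then have "awalk (head G e) [e'] u"
    by (auto simp: awalk_Cons_iff awalk_Nil_iff)
  then show ?case
    using q by (intro exI[of _ "q @ [e']"]) auto
qed

lemma (in sym_digraph) graph_dist_sym: "graph_dist G u v = graph_dist G v u"
proof -
  have "graph_dist G v u \<le> graph_dist G u v" for u v
    unfolding graph_dist_conv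
  proof (rule INF_mono)
    fix p assume "p \<in> {p. awalk u p v}"
    then show "\<exists>q\<in>{q. awalk v q u}. ereal (real (length q)) \<le> ereal (real (length p))"
      using awalk_reverse[of u p v] by auto
  qed
  then show ?thesis by (simp add: order_antisym)
qed

lemma (in sym_digraph) pair_dist_eq: "pair_dist G {u, v} = graph_dist G u v"
  unfolding pair_dist_def
  by (rule the_equality) (auto simp: doubleton_eq_iff graph_dist_sym)


section \<open>Fibonacci cubes\<close>

text \<open>Positions in a string are counted from 0.\<close>

definition fibonacci_strings :: "nat \<Rightarrow> nat list set" where
  "fibonacci_strings n =
    {b. length b = n \<and> set b \<subseteq> {0, 1} \<and> (\<forall>i. Suc i < n \<longrightarrow> b ! i * b ! Suc i = 0)}"

definition fibonacci_cube :: "nat \<Rightarrow> nat list pair_pre_digraph" where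
  "fibonacci_cube n =
    \<lparr> pverts = fibonacci_strings n,
      parcs = {(b, c). b \<in> fibonacci_strings n \<and> c \<in> fibonacci_strings n \<and>
                       card {i. i < n \<and> b ! i \<noteq> c ! i} = 1} \<rparr>"

lemma finite_fibonacci_strings: "finite (fibonacci_strings n)"
  by (rule finite_subset[OF _ finite_lists_length_eq[of "{0, 1}" n]])
     (auto simp: fibonacci_strings_def)

lemma pair_graph_fibonacci_cube: "pair_graph (fibonacci_cube n)"
proof
  let ?V = "fibonacci_strings n"
  have "parcs (fibonacci_cube n) \<subseteq> ?V \<times> ?V"
    by (auto simp: fibonacci_cube_def)
  then show "finite (parcs (fibonacci_cube n))"
    by (rule finite_subset) (simp add: finite_fibonacci_strings)
  show "symmetric (with_proj (fibonacci_cube n))"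
  proof -
    have *: "{i. i < n \<and> b ! i \<noteq> c ! i} = {i. i < n \<and> c ! i \<noteq> b ! i}" for b c :: "nat list"
      by auto
    show ?thesis
      unfolding symmetric_def fibonacci_cube_def
      by (auto simp: sym_def *)
  qed
qed (auto simp: fibonacci_cube_def finite_fibonacci_strings)

end

theory Submission
  imports Defs
begin

text \<open>
  Clearing a bit never creates two consecutive ones. So any two Fibonacci strings are joined by a
  walk inside the cube that first clears the superfluous ones of the first string and then sets the
  missing ones of the second, and distances in \<open>\<Gamma>\<^sub>n\<close> are Hamming distances
  (\<open>graph_dist_fibonacci_cube\<close>). The Wiener index therefore splits over the coordinates: coordinate
  \<open>i\<close> contributes the number of pairs that it separates, which is the number of strings with a one at
  \<open>i\<close> times the number of strings with a zero at \<open>i\<close>. Cutting a string at a zero leaves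
  two independent Fibonacci strings, so both counts are products of Fibonacci numbers, and
  \<open>W(\<Gamma>\<^sub>n) = (\<Sum>i<n. g i * g (n - 1 - i))\<close> with \<open>g i = fib (i + 1) * fib (i + 2)\<close>
  (\<open>wiener_index_fibonacci_cube\<close>).

  The generating function of \<open>g\<close> is \<open>1 / (1 - 2x - 2x^2 + x^3)\<close>. Multiplying its square by the
  denominator gives a linear recurrence for the convolution with inhomogeneous term \<open>g\<close>
  (\<open>convolution_rec\<close>). As \<open>5 g k = fib (2k + 2) + fib (2k + 4) + (-1)^k\<close> (\<open>fib_mult_fib_Suc\<close>), the
  claim that the closed form obeys the same recurrence is a linear identity between two consecutive
  Fibonacci numbers and \<open>(-1)^n\<close>.
\<close>

section \<open>Distances in the Fibonacci cube\<close>

definition hamming :: "nat \<Rightarrow> 'a list \<Rightarrow> 'a list \<Rightarrow> nat" where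
  "hamming n u v = card {i. i < n \<and> u ! i \<noteq> v ! i}"

lemma hamming_commute: "hamming n u v = hamming n v u"
  unfolding hamming_def by (rule arg_cong[where f = card]) auto

lemma hamming_triangle: "hamming n u w \<le> hamming n u v + hamming n v w"
proof -
  have "hamming n u w \<le> card ({i. i < n \<and> u ! i \<noteq> v ! i} \<union> {i. i < n \<and> v ! i \<noteq> w ! i})"
    unfolding hamming_def by (rule card_mono) auto
  also have "\<dots> \<le> hamming n u v + hamming n v w"
    unfolding hamming_def by (rule card_Un_le)
  finally show ?thesis .
qed

lemma hamming_eq_0_iff:
  assumes "length u = n" "length v = n"
  shows "hamming n u v = 0 \<longleftrightarrow> u = v"
  using assms by (auto simp: hamming_def list_eq_iff_nth_eq)

lemma hamming_list_update:
  assumes "length u = n" "i < n" "u ! i \<noteq> v ! i"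
  shows "hamming n u v = Suc (hamming n (u[i := v ! i]) v)"
proof -
  have "{j. j < n \<and> u ! j \<noteq> v ! j} = insert i {j. j < n \<and> u[i := v ! i] ! j \<noteq> v ! j}"
    using assms by (auto simp: nth_list_update)
  moreover have "i \<notin> {j. j < n \<and> u[i := v ! i] ! j \<noteq> v ! j}"
    using assms by simp
  ultimately show ?thesis
    by (simp add: hamming_def)
qed

lemma length_fibonacci_strings: "u \<in> fibonacci_strings n \<Longrightarrow> length u = n"
  by (simp add: fibonacci_strings_def)

lemma nth_fibonacci_strings:
  "u \<in> fibonacci_strings n \<Longrightarrow> i < n \<Longrightarrow> u ! i = 0 \<or> u ! i = 1"
proof -
  assume u: "u \<in> fibonacci_strings n" and i: "i < n"
  have "u ! i \<in> set u"
    using u i by (simp add: fibonacci_strings_def)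
  then show ?thesis
    using u by (auto simp: fibonacci_strings_def simp del: One_nat_def)
qed

lemma clear_bit_fibonacci_strings:
  assumes "u \<in> fibonacci_strings n"
  shows "u[i := 0] \<in> fibonacci_strings n"
proof -
  have "set (u[i := 0]) \<subseteq> {0, 1}"
    using assms set_update_subset_insert[of u i 0] by (auto simp: fibonacci_strings_def)
  moreover have "u[i := 0] ! j * u[i := 0] ! Suc j = 0" if "Suc j < n" for j
    using assms that by (cases "i = j"; cases "i = Suc j") (auto simp: fibonacci_strings_def)
  ultimately show ?thesis
    using assms by (simp add: fibonacci_strings_def)
qed

lemma verts_fibonacci_cube: "verts (with_proj (fibonacci_cube n)) = fibonacci_strings n"
  by (simp add: fibonacci_cube_def)

lemma arcs_fibonacci_cube:
  "arcs (with_proj (fibonacci_cube n)) =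
    {(u, v). u \<in> fibonacci_strings n \<and> v \<in> fibonacci_strings n \<and> hamming n u v = 1}"
  by (simp add: fibonacci_cube_def hamming_def)

lemma graph_fibonacci_cube: "graph (with_proj (fibonacci_cube n))"
  by (rule pair_graph.pair_graphD_graph[OF pair_graph_fibonacci_cube])

context
  fixes n :: nat
begin

interpretation graph "with_proj (fibonacci_cube n)"
  by (rule graph_fibonacci_cube)

lemma hamming_le_length_awalk: "awalk u p v \<Longrightarrow> hamming n u v \<le> length p"
proof (induction p arbitrary: u)
  case Nil
  then show ?case by (simp add: awalk_Nil_iff hamming_def)
next
  case (Cons a p)
  obtain x y where a: "a = (x, y)" by (cases a)
  have xy: "x = u" "hamming n u y = 1" "awalk y p v"
    using Cons.prems arcs_fibonacci_cube[of n] unfolding a by (auto simp: awalk_Cons_iff)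
  show ?case
    using hamming_triangle[of n u v y] Cons.IH[OF xy(3)] xy(2) by simp
qed

text \<open>
  Only clearing a bit is safe, so the step is taken from the end that has a superfluous one;
  reversing walks makes the two ends interchangeable.
\<close>

lemma ex_awalk_hamming:
  assumes "u \<in> fibonacci_strings n" "v \<in> fibonacci_strings n"
  shows "\<exists>p. awalk u p v \<and> length p = hamming n u v"
  using assms
proof (induction "hamming n u v" arbitrary: u v)
  case 0
  then have "u = v"
    using hamming_eq_0_iff[of u n v] by (simp add: length_fibonacci_strings)
  then show ?case
    using 0 verts_fibonacci_cube[of n] by (intro exI[of _ "[]"]) (simp add: awalk_Nil_iff)
next
  case (Suc k)
  have clear: "\<exists>p. awalk x p y \<and> length p = Suc k"
    if xy: "x \<in> fibonacci_strings n" "y \<in> fibonacci_strings n" "hamming n x y = Suc k"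
      and i: "i < n" "x ! i = 1" "y ! i = 0" for x y i
  proof -
    let ?x = "x[i := 0]"
    have len: "length x = n"
      using xy(1) by (rule length_fibonacci_strings)
    have mem: "?x \<in> fibonacci_strings n"
      using xy(1) by (rule clear_bit_fibonacci_strings)
    have k: "hamming n ?x y = k"
      using hamming_list_update[of x n i y] len i xy(3) by simp
    obtain p where p: "awalk ?x p y" "length p = k"
      using Suc.hyps(1)[of ?x y] k mem xy(2) by auto
    have "hamming n x ?x = 1"
      using hamming_list_update[of x n i ?x] len i hamming_eq_0_iff[of ?x n ?x] by simp
    then have "(x, ?x) \<in> arcs (with_proj (fibonacci_cube n))"
      using xy(1) mem arcs_fibonacci_cube[of n] by auto
    then have "awalk x ((x, ?x) # p) y"
      using p(1) xy(1) verts_fibonacci_cube[of n] by (auto simp: awalk_Cons_iff)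
    then show ?thesis
      using p(2) by (intro exI[of _ "(x, ?x) # p"]) simp
  qed
  have "{i. i < n \<and> u ! i \<noteq> v ! i} \<noteq> {}"
    using Suc.hyps(2) unfolding hamming_def by (metis card.empty nat.distinct(1))
  then obtain i where i: "i < n" "u ! i \<noteq> v ! i"
    by blast
  then consider "u ! i = 1" "v ! i = 0" | "v ! i = 1" "u ! i = 0"
    using nth_fibonacci_strings[OF Suc.prems(1) i(1)]
      nth_fibonacci_strings[OF Suc.prems(2) i(1)] by auto
  then show ?case
  proof cases
    case 1
    then show ?thesis
      using clear[of u v i] Suc.prems Suc.hyps(2) i(1) by simp
  next
    case 2
    then have "\<exists>p. awalk v p u \<and> length p = Suc k"
      using clear[of v u i] Suc.prems Suc.hyps(2) i(1) by (simp add: hamming_commute)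
    then show ?thesis
      using awalk_reverse[of v _ u] Suc.hyps(2) by metis
  qed
qed

lemma graph_dist_fibonacci_cube:
  assumes "u \<in> fibonacci_strings n" "v \<in> fibonacci_strings n"
  shows "graph_dist (with_proj (fibonacci_cube n)) u v = ereal (real (hamming n u v))"
  unfolding graph_dist_conv
proof (rule antisym)
  obtain p where "awalk u p v" "length p = hamming n u v"
    using ex_awalk_hamming[OF assms] by blast
  then show "(INF p\<in>{p. awalk u p v}. ereal (real (length p))) \<le> ereal (real (hamming n u v))"
    by (intro INF_lower2[of p]) auto
next
  show "ereal (real (hamming n u v)) \<le> (INF p\<in>{p. awalk u p v}. ereal (real (length p)))"
    by (rule INF_greatest) (use hamming_le_length_awalk in auto)
qed

lemma pair_dist_fibonacci_cube:
  assumes "u \<in> fibonacci_strings n" "v \<in> fibonacci_strings n"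
  shows "pair_dist (with_proj (fibonacci_cube n)) {u, v} = ereal (real (hamming n u v))"
  using graph_dist_fibonacci_cube[OF assms] by (simp add: pair_dist_eq)

end

section \<open>Counting Fibonacci strings\<close>

lemma Cons_fibonacci_strings_iff:
  "a # w \<in> fibonacci_strings (Suc n) \<longleftrightarrow>
    a \<in> {0, 1} \<and> w \<in> fibonacci_strings n \<and> (w = [] \<or> a = 0 \<or> hd w = 0)"
proof -
  have "(\<forall>i. Suc i < Suc n \<longrightarrow> (a # w) ! i * (a # w) ! Suc i = 0) \<longleftrightarrow>
      (\<forall>i. Suc i < n \<longrightarrow> w ! i * w ! Suc i = 0) \<and> (n = 0 \<or> a = 0 \<or> w ! 0 = 0)"
    (is "?L \<longleftrightarrow> ?R")
  proof
    assume L: ?L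
    have "n = 0 \<or> a = 0 \<or> w ! 0 = 0"
      using L[rule_format, of 0] by auto
    moreover have "w ! i * w ! Suc i = 0" if "Suc i < n" for i
      using L[rule_format, of "Suc i"] that by simp
    ultimately show ?R by blast
  next
    assume R: ?R
    show ?L
    proof (intro allI impI)
      fix i assume "Suc i < Suc n"
      then show "(a # w) ! i * (a # w) ! Suc i = 0"
        using R by (cases i) auto
    qed
  qed
  then show ?thesis
    by (auto simp: fibonacci_strings_def hd_conv_nth)
qed

lemma fibonacci_strings_0: "fibonacci_strings 0 = {[]}"
  by (auto simp: fibonacci_strings_def)

lemma fibonacci_strings_1: "fibonacci_strings (Suc 0) = {[0], [1]}"
  by (auto simp: fibonacci_strings_def length_Suc_conv)

lemma fibonacci_strings_Suc_Suc:
  "fibonacci_strings (Suc (Suc n)) =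
    (#) 0 ` fibonacci_strings (Suc n) \<union> (\<lambda>w. 1 # 0 # w) ` fibonacci_strings n"
    (is "?L = ?R")
proof (rule set_eqI)
  fix u
  show "u \<in> ?L \<longleftrightarrow> u \<in> ?R"
  proof (cases "length u = Suc (Suc n)")
    case True
    then obtain a b w where "u = a # b # w"
      by (auto simp: length_Suc_conv)
    then show ?thesis
      by (auto simp: Cons_fibonacci_strings_iff)
  next
    case False
    then show ?thesis
      by (auto simp: fibonacci_strings_def)
  qed
qed

lemma card_fibonacci_strings: "card (fibonacci_strings n) = fib (n + 2)"
proof (induction n rule: fib.induct)
  case 1
  show ?case by (simp add: fibonacci_strings_0)
next
  case 2
  show ?case by (simp add: fibonacci_strings_1)
next
  case (3 n)
  have "card (fibonacci_strings (Suc (Suc n))) =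
      card (((#) 0) ` fibonacci_strings (Suc n)) + card ((\<lambda>w. 1 # 0 # w) ` fibonacci_strings n)"
    unfolding fibonacci_strings_Suc_Suc
    by (rule card_Un_disjoint) (auto simp: finite_fibonacci_strings)
  also have "\<dots> = card (fibonacci_strings (Suc n)) + card (fibonacci_strings n)"
    by (simp add: card_image inj_on_def)
  finally show ?case
    using 3 by simp
qed

lemma append_zero_fibonacci_strings_iff:
  "length x = i \<Longrightarrow>
    x @ 0 # y \<in> fibonacci_strings (i + Suc k) \<longleftrightarrow> x \<in> fibonacci_strings i \<and> y \<in> fibonacci_strings k"
proof (induction x arbitrary: i)
  case Nil
  then show ?case by (simp add: Cons_fibonacci_strings_iff fibonacci_strings_0)
next
  case (Cons a x)
  then have "i = Suc (length x)" by simp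
  then show ?case
    using Cons.IH[OF refl] by (cases x) (auto simp: Cons_fibonacci_strings_iff)
qed

lemma card_zero_at:
  "card {u \<in> fibonacci_strings (i + Suc k). u ! i = 0} = fib (i + 2) * fib (k + 2)"
proof -
  have "bij_betw (\<lambda>(x, y). x @ 0 # y) (fibonacci_strings i \<times> fibonacci_strings k)
      {u \<in> fibonacci_strings (i + Suc k). u ! i = 0}"
  proof (rule bij_betw_imageI)
    show "inj_on (\<lambda>(x, y). x @ 0 # y) (fibonacci_strings i \<times> fibonacci_strings k)"
      by (clarsimp simp: inj_on_def) (metis append_eq_append_conv length_fibonacci_strings list.inject)
    show "(\<lambda>(x, y). x @ 0 # y) ` (fibonacci_strings i \<times> fibonacci_strings k) =
        {u \<in> fibonacci_strings (i + Suc k). u ! i = 0}" (is "?L = ?R")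
    proof (intro equalityI subsetI)
      fix u assume "u \<in> ?L"
      then obtain x y where u: "u = x @ 0 # y" and xy: "x \<in> fibonacci_strings i" "y \<in> fibonacci_strings k"
        by auto
      have "length x = i"
        using xy(1) by (rule length_fibonacci_strings)
      then show "u \<in> ?R"
        using u xy append_zero_fibonacci_strings_iff[of x i y k] nth_append_length[of x 0 y] by auto
    next
      fix u assume "u \<in> ?R"
      then have u: "u \<in> fibonacci_strings (i + Suc k)" "u ! i = 0" and len: "length u = i + Suc k"
        by (auto dest: length_fibonacci_strings)
      have eq: "u = take i u @ 0 # drop (Suc i) u"
        using id_take_nth_drop[of i u] len u(2) by simp
      then have "take i u \<in> fibonacci_strings i" "drop (Suc i) u \<in> fibonacci_strings k"
        using append_zero_fibonacci_strings_iff[of "take i u" i "drop (Suc i) u" k] u(1) len by auto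
      then show "u \<in> ?L"
        using eq by (intro image_eqI[of _ _ "(take i u, drop (Suc i) u)"]) auto
    qed
  qed
  then show ?thesis
    by (simp add: bij_betw_same_card[symmetric] card_cartesian_product card_fibonacci_strings
        del: fib.simps)
qed

text \<open>
  The strings with a one at \<open>i\<close> are counted as the complement; the addition formula for Fibonacci
  numbers turns the difference into a product.
\<close>

lemma card_one_at:
  "card {u \<in> fibonacci_strings (i + Suc k). u ! i = 1} = fib (i + 1) * fib (k + 1)"
proof -
  have "fibonacci_strings (i + Suc k) = {u \<in> fibonacci_strings (i + Suc k). u ! i = 0}
      \<union> {u \<in> fibonacci_strings (i + Suc k). u ! i = 1}"
    using nth_fibonacci_strings[of _ "i + Suc k" i] by auto
  then have "card (fibonacci_strings (i + Suc k)) =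
      card {u \<in> fibonacci_strings (i + Suc k). u ! i = 0}
      + card {u \<in> fibonacci_strings (i + Suc k). u ! i = 1}"
    by (subst card_Un_disjoint[symmetric]) (auto simp: finite_fibonacci_strings)
  then have "fib (i + Suc k + 2) = fib (i + 2) * fib (k + 2)
      + card {u \<in> fibonacci_strings (i + Suc k). u ! i = 1}"
    by (simp only: card_fibonacci_strings card_zero_at)
  moreover have "fib (i + Suc k + 2) = fib (i + 2) * fib (k + 2) + fib (i + 1) * fib (k + 1)"
    using fib_add[of "k + 1" "i + 1"] by (simp add: ac_simps del: fib.simps)
  ultimately show ?thesis by linarith
qed

section \<open>The Wiener index as a sum over coordinates\<close>

text \<open>
  A separated pair has a canonical orientation, from its string with a one at \<open>i\<close> to the other, so
  no division by two is needed to pass to unordered pairs.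
\<close>

lemma card_separated_pairs:
  fixes n i :: nat
  defines "V \<equiv> fibonacci_strings n"
  shows "card {e. e \<subseteq> V \<and> card e = 2 \<and> (\<exists>u\<in>e. \<exists>v\<in>e. u ! i = 1 \<and> v ! i = 0)}
    = card {u \<in> V. u ! i = 1} * card {u \<in> V. u ! i = 0}"
proof -
  have "bij_betw (\<lambda>(u, v). {u, v}) ({u \<in> V. u ! i = 1} \<times> {u \<in> V. u ! i = 0})
      {e. e \<subseteq> V \<and> card e = 2 \<and> (\<exists>u\<in>e. \<exists>v\<in>e. u ! i = 1 \<and> v ! i = 0)}"
  proof (rule bij_betw_imageI)
    show "inj_on (\<lambda>(u, v). {u, v}) ({u \<in> V. u ! i = 1} \<times> {u \<in> V. u ! i = 0})"
      by (auto simp: inj_on_def doubleton_eq_iff)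
    show "(\<lambda>(u, v). {u, v}) ` ({u \<in> V. u ! i = 1} \<times> {u \<in> V. u ! i = 0}) =
        {e. e \<subseteq> V \<and> card e = 2 \<and> (\<exists>u\<in>e. \<exists>v\<in>e. u ! i = 1 \<and> v ! i = 0)}" (is "?L = ?R")
    proof (intro equalityI subsetI)
      fix e assume "e \<in> ?L"
      then obtain u v where "e = {u, v}" "u \<in> V" "u ! i = 1" "v \<in> V" "v ! i = 0"
        by auto
      moreover from this have "card e = 2"
        by (metis card_2_iff zero_neq_one)
      ultimately show "e \<in> ?R" by auto
    next
      fix e assume "e \<in> ?R"
      then obtain u v where uv: "u \<in> e" "v \<in> e" "u ! i = 1" "v ! i = 0"
        and e: "e \<subseteq> V" "card e = 2"
        by blast
      then have "e = {u, v}"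
        by (auto simp: card_2_iff)
      then show "e \<in> ?L"
        using uv e by (intro image_eqI[of _ _ "(u, v)"]) auto
    qed
  qed
  then show ?thesis
    by (simp add: bij_betw_same_card[symmetric] card_cartesian_product)
qed

lemma wiener_index_fibonacci_cube:
  "wiener_index (with_proj (fibonacci_cube n)) =
    ereal (real (\<Sum>i<n. fib (i + 1) * fib (i + 2) * (fib (n - 1 - i + 1) * fib (n - 1 - i + 2))))"
proof -
  let ?V = "fibonacci_strings n"
  let ?E = "{e. e \<subseteq> ?V \<and> card e = 2}"
  let ?sep = "\<lambda>i e. \<exists>u\<in>e. \<exists>v\<in>e. u ! i = 1 \<and> v ! i = (0::nat)"
  have finE: "finite ?E"
    by (rule finite_subset[of _ "Pow ?V"]) (auto simp: finite_fibonacci_strings)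
  have dist: "pair_dist (with_proj (fibonacci_cube n)) e =
      ereal (real (card {i \<in> {..<n}. ?sep i e}))" if "e \<in> ?E" for e
  proof -
    have "card e = 2" and sub: "e \<subseteq> ?V"
      using that by auto
    then obtain u v where e: "e = {u, v}"
      by (meson card_2_iff)
    with sub have uv: "u \<in> ?V" "v \<in> ?V"
      by auto
    have "{i. i < n \<and> u ! i \<noteq> v ! i} = {i \<in> {..<n}. ?sep i e}"
      using nth_fibonacci_strings[OF uv(1)] nth_fibonacci_strings[OF uv(2)] unfolding e by fastforce
    then show ?thesis
      using pair_dist_fibonacci_cube[OF uv] by (simp add: e hamming_def)
  qed
  have count: "card {e \<in> ?E. ?sep i e} =
      fib (i + 1) * fib (i + 2) * (fib (n - 1 - i + 1) * fib (n - 1 - i + 2))"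
    if "i < n" for i
  proof -
    define k where "k = n - 1 - i"
    have n: "n = i + Suc k"
      using that by (simp add: k_def)
    have "card {e \<in> ?E. ?sep i e} = card {u \<in> ?V. u ! i = 1} * card {u \<in> ?V. u ! i = 0}"
      using card_separated_pairs[of n i] by (simp add: conj_assoc)
    also have "\<dots> = fib (i + 1) * fib (k + 1) * (fib (i + 2) * fib (k + 2))"
      unfolding n card_one_at card_zero_at ..
    finally show ?thesis
      unfolding k_def by (simp add: ac_simps del: fib.simps)
  qed
  have "wiener_index (with_proj (fibonacci_cube n)) =
      (\<Sum>e\<in>?E. ereal (real (card {i \<in> {..<n}. ?sep i e})))"
    unfolding wiener_index_def verts_fibonacci_cube by (rule sum.cong[OF refl dist])
  also have "\<dots> = ereal (real (\<Sum>e\<in>?E. card {i \<in> {..<n}. ?sep i e}))"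
    by simp
  also have "(\<Sum>e\<in>?E. card {i \<in> {..<n}. ?sep i e}) =
      (\<Sum>i<n. fib (i + 1) * fib (i + 2) * (fib (n - 1 - i + 1) * fib (n - 1 - i + 2)))"
    by (rule sum_multicount_gen[OF finE]) (use count in auto)
  finally show ?thesis .
qed

section \<open>The closed form\<close>

text \<open>
  The initial values say that the generating function of \<open>g\<close> is \<open>1 / (1 - 2x - 2x^2 + x^3)\<close>, with
  numerator exactly 1; this is why a single term \<open>g (m + 2)\<close> survives.
\<close>

lemma convolution_rec:
  fixes g :: "nat \<Rightarrow> 'a::comm_ring_1"
  assumes rec: "\<And>i. g (i + 3) = 2 * g (i + 2) + 2 * g (i + 1) - g i"
    and init: "g 0 = 1" "g 1 = 2" "g 2 = 6"
  defines "c \<equiv> \<lambda>n. \<Sum>i<n. g i * g (n - 1 - i)"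
  shows "c (m + 3) = 2 * c (m + 2) + 2 * c (m + 1) - c m + g (m + 2)"
proof -
  \<comment> \<open>All four convolutions are compared on the common range \<open>i < m\<close>, where the recurrence applies to
    the second factor.\<close>
  define S where "S = (\<lambda>j. \<Sum>i<m. g i * g (m - 1 - i + j))"
  have shift: "(\<Sum>i<m. g i * g (m + j - 1 - i)) = S j" for j
    unfolding S_def by (rule sum.cong) (auto intro!: arg_cong[where f = g])
  have c0: "c m = S 0"
    using shift[of 0] by (simp add: c_def)
  have c1: "c (m + 1) = S 1 + g m"
    using shift[of 1] init by (simp add: c_def)
  have c2: "c (m + 2) = S 2 + 2 * g m + g (m + 1)"
    using shift[of 2] init by (simp add: c_def numeral_2_eq_2 algebra_simps)
  have c3: "c (m + 3) = S 3 + 6 * g m + 2 * g (m + 1) + g (m + 2)"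
    using shift[of 3] init by (simp add: c_def numeral_2_eq_2 numeral_3_eq_3 algebra_simps)
  have "S 3 = 2 * S 2 + 2 * S 1 - S 0"
    unfolding S_def sum_distrib_left sum.distrib[symmetric] sum_subtractf[symmetric]
  proof (rule sum.cong[OF refl])
    fix i
    show "g i * g (m - 1 - i + 3) =
        2 * (g i * g (m - 1 - i + 2)) + 2 * (g i * g (m - 1 - i + 1)) - g i * g (m - 1 - i + 0)"
      using rec[of "m - 1 - i"] by (simp del: One_nat_def add: right_diff_distrib distrib_left mult.left_commute)
  qed
  then show ?thesis
    unfolding c0 c1 c2 c3 by (simp add: algebra_simps)
qed

lemma induct_nat_3 [case_names 0 1 2 step]:
  assumes "P 0" "P 1" "P 2" "\<And>m. P m \<Longrightarrow> P (m + 1) \<Longrightarrow> P (m + 2) \<Longrightarrow> P (m + 3)"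
  shows "P (n :: nat)"
proof (induction n rule: less_induct)
  case (less n)
  consider "n = 0" | "n = 1" | "n = 2" | m where "n = m + 3"
    by (metis One_nat_def Suc_1 add.commute add_Suc_right le_add_diff_inverse not_less_eq_eq
        numeral_3_eq_3 le_Suc_eq le_zero_eq)
  then show ?case
    using assms less by cases auto
qed

lemma fib_prod_rec:
  fixes i :: nat
  defines "g \<equiv> \<lambda>i. real (fib (i + 1)) * real (fib (i + 2))"
  shows "g (i + 3) = 2 * g (i + 2) + 2 * g (i + 1) - g i"
  by (simp add: g_def numeral_eq_Suc algebra_simps)

text \<open>
  This linearises the inhomogeneous term: both sides satisfy the recurrence of \<open>fib_prod_rec\<close>, whose
  characteristic roots are \<open>-1\<close> and the squares of the golden ratio and of its conjugate.
\<close>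

lemma fib_mult_fib_Suc:
  "5 * (real (fib (k + 1)) * real (fib (k + 2))) =
    real (fib (2 * k + 2)) + real (fib (2 * k + 4)) + (- 1) ^ k"
proof (induction k rule: induct_nat_3)
  case (step m)
  have "5 * (real (fib (m + 3 + 1)) * real (fib (m + 3 + 2))) =
      2 * (5 * (real (fib (m + 2 + 1)) * real (fib (m + 2 + 2))))
      + 2 * (5 * (real (fib (m + 1 + 1)) * real (fib (m + 1 + 2))))
      - 5 * (real (fib (m + 1)) * real (fib (m + 2)))"
    using fib_prod_rec[of m] by (simp only: algebra_simps)
  then show ?case
    unfolding step by (simp add: numeral_eq_Suc algebra_simps)
qed (simp_all add: numeral_eq_Suc)

lemma fib_convolution:
  "25 * (\<Sum>i<n. real (fib (i + 1)) * real (fib (i + 2))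
        * (real (fib (n - 1 - i + 1)) * real (fib (n - 1 - i + 2)))) =
    (3 * real n + 2) * real (fib (2 * n + 3)) + (real n - 2) * real (fib (2 * n + 2))
      - (real n + 2) * (- 1) ^ n"
    (is "25 * ?c n = _")
proof (induction n rule: induct_nat_3)
  case (step m)
  have "?c (m + 3) = 2 * ?c (m + 2) + 2 * ?c (m + 1) - ?c m
      + real (fib (m + 2 + 1)) * real (fib (m + 2 + 2))"
    by (rule convolution_rec[where g = "\<lambda>i. real (fib (i + 1)) * real (fib (i + 2))"])
      (use fib_prod_rec in \<open>simp_all add: numeral_eq_Suc\<close>)
  then have "25 * ?c (m + 3) = 2 * (25 * ?c (m + 2)) + 2 * (25 * ?c (m + 1)) - 25 * ?c m
      + 5 * (5 * (real (fib (m + 2 + 1)) * real (fib (m + 2 + 2))))"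
    by linarith
  then show ?case
    unfolding step fib_mult_fib_Suc by (simp add: numeral_eq_Suc algebra_simps)
qed (simp_all add: numeral_eq_Suc)

theorem mainTheorem5:
  fixes n :: nat
  assumes "n \<ge> 2"
  shows "wiener_index (with_proj (fibonacci_cube n)) =
    ereal (1 / 25 * ((3 * real n + 2) * real (fib (2 * n + 3))
                   + (real n - 2) * real (fib (2 * n + 2))
                   - (real n + 2) * (- 1) ^ n))"
  unfolding wiener_index_fibonacci_cube using fib_convolution[of n]
  by (simp del: fib.simps)

end
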